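(* Let $\Gamma$ be a finite group, $(G,g,f)$ a third-type datum, $A=k[\Gamma]$, $H=\mathfrak A^3_G(g,f)$, and let $(A,H,\triangleright,\triangleleft)$ be a matched pair of Hopf algebras. Then for every $h\in\Gamma$, $$g\triangleright h=h,\qquad x\triangleright h=0.$$ Consequently, if $G=\langle g\rangle$, then the whole left action is trivial: $u\triangleright h=\varepsilon_H(u)h$ for all $u\in H$, $h\in\Gamma$.
   Context: $k$ is an algebraically closed field of characteristic $p>0$; all algebras, tensor products etc. are over $k$; all groups are finite. A third-type datum is a triple $(G,g,f)$ where $G$ is a finite group, $g\in Z(G)$, $f:G\to(k,+)$ is a group homomorphism with $f(g)=1$, and $(f(t)^p-f(t))(1-g^p)=0$ in $k[G]$ for all $t\in G$. The Hopf algebra $\mathfrak A^3_G(g,f)$ is generated as an algebra by the group algebra $k[G]$ and an element $x$ subject to $tx-xt=f(t)\,t(1-g)$ for $t\in G$ and $x^p=x$, with $\Delta(t)=t\otimes t$, $\varepsilon(t)=1$, $S(t)=t^{-1}$ for $t\in G$, and $\Delta(x)=x\otimes 1+g\otimes x$, $\varepsilon(x)=0$, $S(x)=-g^{-1}x$. It has basis $\{tx^i\mid t\in G,\ 0\le i<p\}$. A matched pair of Hopf algebras $(A,H,\triangleright,\triangleleft)$ consists of a left action $\triangleright:H\otimes A\to A$ making $A$ a left $H$-module coalgebra and a right action $\triangleleft:H\otimes A\to H$ making $H$ a right $A$-module coalgebra such that, for $a,b\in A$, $u,v\in H$ (Sweedler notation): $u\triangleright 1=\varepsilon(u)1$, $1\triangleleft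 a=\varepsilon(a)1$; $u\triangleright(ab)=(u_{(1)}\triangleright a_{(1)})((u_{(2)}\triangleleft a_{(2)})\triangleright b)$; $(uv)\triangleleft a=(u\triangleleft(v_{(1)}\triangleright a_{(1)}))(v_{(2)}\triangleleft a_{(2)})$; $u_{(1)}\triangleleft a_{(1)}\otimes u_{(2)}\triangleright a_{(2)}=u_{(2)}\triangleleft a_{(2)}\otimes u_{(1)}\triangleright a_{(1)}$. *)

theory Defs
  imports
    "HOL-Library.Multiset"
    "HOL-Library.Poly_Mapping"
    "HOL-Computational_Algebra.Polynomial"
begin

section \<open>Tensor products\<close>

text \<open>
  An element \<open>\<Sum>\<^sub>i v\<^sub>i \<otimes> w\<^sub>i\<close> of \<open>V \<otimes> W\<close> is written as the finite multiset of the pairs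
  \<open>(v\<^sub>i, w\<^sub>i)\<close>, where \<open>V\<close> and \<open>W\<close> are the vector spaces given by the types \<open>'v\<close>, \<open>'w\<close> with the
  scalar multiplications \<open>sV\<close>, \<open>sW\<close>. Two such multisets denote the same tensor iff they are
  related by \<open>tensor_eq sV sW\<close>, the least congruence of the free commutative monoid on
  \<open>V \<times> W\<close> making \<open>(v, w) \<mapsto> v \<otimes> w\<close> bilinear. The quotient by this congruence is \<open>V \<otimes> W\<close>;
  additive inverses exist there because \<open>(-v, w)\<close> is inverse to \<open>(v, w)\<close>.
\<close>

inductive tensor_eq ::
  "('k \<Rightarrow> 'v \<Rightarrow> 'v) \<Rightarrow> ('k \<Rightarrow> 'w \<Rightarrow> 'w) \<Rightarrow>
   ('v::ab_group_add \<times> 'w::ab_group_add) multiset \<Rightarrow> ('v \<times> 'w) multiset \<Rightarrow> bool"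
  for sV sW where
  refl: "tensor_eq sV sW M M"
| sym: "tensor_eq sV sW M N \<Longrightarrow> tensor_eq sV sW N M"
| trans: "tensor_eq sV sW L M \<Longrightarrow> tensor_eq sV sW M N \<Longrightarrow> tensor_eq sV sW L N"
| cong: "tensor_eq sV sW M N \<Longrightarrow> tensor_eq sV sW (M + L) (N + L)"
| zero: "tensor_eq sV sW {#(0, w)#} {#}"
| add_left: "tensor_eq sV sW {#(v + v', w)#} {#(v, w), (v', w)#}"
| add_right: "tensor_eq sV sW {#(v, w + w')#} {#(v, w), (v, w')#}"
| scale: "tensor_eq sV sW {#(sV c v, w)#} {#(v, sW c w)#}"

text \<open>The same encoding for \<open>V \<otimes> V \<otimes> V\<close>.\<close>

inductive tensor3_eq ::
  "('k \<Rightarrow> 'v \<Rightarrow> 'v) \<Rightarrow> ('v::ab_group_add \<times> 'v \<times> 'v) multiset \<Rightarrow> ('v \<times> 'v \<times> 'v) multiset \<Rightarrow> bool"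
  for s where
  refl: "tensor3_eq s M M"
| sym: "tensor3_eq s M N \<Longrightarrow> tensor3_eq s N M"
| trans: "tensor3_eq s L M \<Longrightarrow> tensor3_eq s M N \<Longrightarrow> tensor3_eq s L N"
| cong: "tensor3_eq s M N \<Longrightarrow> tensor3_eq s (M + L) (N + L)"
| zero: "tensor3_eq s {#(0, v, w)#} {#}"
| add_1: "tensor3_eq s {#(u + u', v, w)#} {#(u, v, w), (u', v, w)#}"
| add_2: "tensor3_eq s {#(u, v + v', w)#} {#(u, v, w), (u, v', w)#}"
| add_3: "tensor3_eq s {#(u, v, w + w')#} {#(u, v, w), (u, v, w')#}"
| scale_12: "tensor3_eq s {#(s c u, v, w)#} {#(u, s c v, w)#}"
| scale_23: "tensor3_eq s {#(u, s c v, w)#} {#(u, v, s c w)#}"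


section \<open>Hopf algebras and matched pairs\<close>

text \<open>
  The ring structure is that of the type \<open>'h\<close>. The value \<open>comult H u\<close> is a representative
  \<open>{#(u\<^sub>1, u\<^sub>2), \<dots>#}\<close> of the tensor \<open>\<Delta>(u) = \<Sum> u\<^sub>1 \<otimes> u\<^sub>2\<close>, so a Sweedler expression is a sum
  over \<open>(u\<^sub>1, u\<^sub>2) \<in># comult H u\<close>; all conditions below are invariant under \<open>tensor_eq\<close>.
\<close>

record ('k, 'h) hopf =
  hscale :: "'k \<Rightarrow> 'h \<Rightarrow> 'h"
  comult :: "'h \<Rightarrow> ('h \<times> 'h) multiset"
  counit :: "'h \<Rightarrow> 'k"
  antipode :: "'h \<Rightarrow> 'h"

abbreviation hopf_tensor_eq ::
  "('k, 'h::ring_1) hopf \<Rightarrow> ('h \<times> 'h) multiset \<Rightarrow> ('h \<times> 'h) multiset \<Rightarrow> bool" where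
  "hopf_tensor_eq H \<equiv> tensor_eq (hscale H) (hscale H)"

locale hopf_algebra =
  fixes H :: "('k::field, 'h::ring_1) hopf"
  assumes vector_space: "vector_space (hscale H)"
    and scale_mult_left: "hscale H c u * v = hscale H c (u * v)"
    and scale_mult_right: "u * hscale H c v = hscale H c (u * v)"
    and comult_add: "hopf_tensor_eq H (comult H (u + v)) (comult H u + comult H v)"
    and comult_scale: "hopf_tensor_eq H (comult H (hscale H c u))
          (\<Sum>(u1, u2)\<in>#comult H u. {#(hscale H c u1, u2)#})"
    and counit_linear: "Vector_Spaces.linear (hscale H) (*) (counit H)"
    and antipode_linear: "Vector_Spaces.linear (hscale H) (hscale H) (antipode H)"
    and coassoc: "tensor3_eq (hscale H)
          (\<Sum>(u1, u2)\<in>#comult H u. \<Sum>(a, b)\<in>#comult H u1. {#(a, b, u2)#})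
          (\<Sum>(u1, u2)\<in>#comult H u. \<Sum>(a, b)\<in>#comult H u2. {#(u1, a, b)#})"
    and counit_left: "(\<Sum>(u1, u2)\<in>#comult H u. hscale H (counit H u1) u2) = u"
    and counit_right: "(\<Sum>(u1, u2)\<in>#comult H u. hscale H (counit H u2) u1) = u"
    and comult_one: "hopf_tensor_eq H (comult H 1) {#(1, 1)#}"
    and comult_mult: "hopf_tensor_eq H (comult H (u * v))
          (\<Sum>(u1, u2)\<in>#comult H u. \<Sum>(v1, v2)\<in>#comult H v. {#(u1 * v1, u2 * v2)#})"
    and counit_one: "counit H 1 = 1"
    and counit_mult: "counit H (u * v) = counit H u * counit H v"
    and antipode_left: "(\<Sum>(u1, u2)\<in>#comult H u. antipode H u1 * u2) = hscale H (counit H u) 1"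
    and antipode_right: "(\<Sum>(u1, u2)\<in>#comult H u. u1 * antipode H u2) = hscale H (counit H u) 1"

text \<open>
  \<open>lact u a\<close> is \<open>u \<triangleright> a\<close> and \<open>ract u a\<close> is \<open>u \<triangleleft> a\<close>. Linear maps out of \<open>H \<otimes> A\<close> are given as
  bilinear maps.
\<close>

locale matched_pair =
  fixes A :: "('k::field, 'a::ring_1) hopf"
    and H :: "('k, 'h::ring_1) hopf"
    and lact :: "'h \<Rightarrow> 'a \<Rightarrow> 'a"
    and ract :: "'h \<Rightarrow> 'a \<Rightarrow> 'h"
  assumes hopf_A: "hopf_algebra A"
    and hopf_H: "hopf_algebra H"
    and lact_linear_left: "Vector_Spaces.linear (hscale H) (hscale A) (\<lambda>u. lact u a)"
    and lact_linear_right: "Vector_Spaces.linear (hscale A) (hscale A) (\<lambda>a. lact u a)"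
    and ract_linear_left: "Vector_Spaces.linear (hscale H) (hscale H) (\<lambda>u. ract u a)"
    and ract_linear_right: "Vector_Spaces.linear (hscale A) (hscale H) (\<lambda>a. ract u a)"
    \<comment> \<open>\<open>A\<close> is a left \<open>H\<close>-module coalgebra\<close>
    and lact_one: "lact 1 a = a"
    and lact_mult: "lact (u * v) a = lact u (lact v a)"
    and lact_comult: "hopf_tensor_eq A (comult A (lact u a))
          (\<Sum>(u1, u2)\<in>#comult H u. \<Sum>(a1, a2)\<in>#comult A a. {#(lact u1 a1, lact u2 a2)#})"
    and lact_counit: "counit A (lact u a) = counit H u * counit A a"
    \<comment> \<open>\<open>H\<close> is a right \<open>A\<close>-module coalgebra\<close>
    and ract_one: "ract u 1 = u"
    and ract_mult: "ract u (a * b) = ract (ract u a) b"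
    and ract_comult: "hopf_tensor_eq H (comult H (ract u a))
          (\<Sum>(u1, u2)\<in>#comult H u. \<Sum>(a1, a2)\<in>#comult A a. {#(ract u1 a1, ract u2 a2)#})"
    and ract_counit: "counit H (ract u a) = counit H u * counit A a"
    \<comment> \<open>compatibility\<close>
    and lact_on_one: "lact u 1 = hscale A (counit H u) 1"
    and one_ract: "ract 1 a = hscale H (counit A a) 1"
    and lact_on_mult: "lact u (a * b) =
          (\<Sum>(u1, u2)\<in>#comult H u. \<Sum>(a1, a2)\<in>#comult A a. lact u1 a1 * lact (ract u2 a2) b)"
    and mult_ract: "ract (u * v) a =
          (\<Sum>(v1, v2)\<in>#comult H v. \<Sum>(a1, a2)\<in>#comult A a. ract u (lact v1 a1) * ract v2 a2)"
    and twist: "tensor_eq (hscale H) (hscale A)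
          (\<Sum>(u1, u2)\<in>#comult H u. \<Sum>(a1, a2)\<in>#comult A a. {#(ract u1 a1, lact u2 a2)#})
          (\<Sum>(u1, u2)\<in>#comult H u. \<Sum>(a1, a2)\<in>#comult A a. {#(ract u2 a2, lact u1 a1)#})"


section \<open>Group algebras\<close>

text \<open>
  A finite group is a type of class \<open>{group_add, finite}\<close>. The class \<open>group_add\<close> is not assumed
  commutative, so the group law is written \<open>s + t\<close> although \<open>G\<close> may be non-abelian, the neutral
  element is \<open>0\<close> and inverses are \<open>- t\<close>. With this, \<open>'g \<Rightarrow>\<^sub>0 'k\<close> with its convolution product is
  the group algebra \<open>k[G]\<close>, in which \<open>t \<in> G\<close> is \<open>grp_elt t\<close>.
\<close>

abbreviation grp_elt :: "'g \<Rightarrow> ('g \<Rightarrow>\<^sub>0 'k::zero_neq_one)" where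
  "grp_elt t \<equiv> Poly_Mapping.single t 1"

definition group_hopf :: "('k::field, 'g::{group_add,finite} \<Rightarrow>\<^sub>0 'k) hopf" where
  "group_hopf =
    \<lparr> hscale = (\<lambda>c a. Poly_Mapping.single 0 c * a),
      comult = (\<lambda>a. \<Sum>t\<in>UNIV. {#(Poly_Mapping.single t (Poly_Mapping.lookup a t), grp_elt t)#}),
      counit = (\<lambda>a. \<Sum>t\<in>UNIV. Poly_Mapping.lookup a t),
      antipode = (\<lambda>a. \<Sum>t\<in>UNIV. Poly_Mapping.single (- t) (Poly_Mapping.lookup a t)) \<rparr>"

lemma tensor_eq_add:
  assumes "tensor_eq sV sW M N" "tensor_eq sV sW M' N'"
  shows "tensor_eq sV sW (M + M') (N + N')"
  by (metis add.commute assms tensor_eq.cong tensor_eq.trans)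

lemma tensor_eq_sum:
  assumes "\<And>i. i \<in> I \<Longrightarrow> tensor_eq sV sW (F i) (G i)"
  shows "tensor_eq sV sW (\<Sum>i\<in>I. F i) (\<Sum>i\<in>I. G i)"
  using assms by (induction I rule: infinite_finite_induct)
    (auto intro: tensor_eq.refl tensor_eq_add)

lemma tensor3_eq_add:
  assumes "tensor3_eq s M N" "tensor3_eq s M' N'"
  shows "tensor3_eq s (M + M') (N + N')"
  by (metis add.commute assms tensor3_eq.cong tensor3_eq.trans)

lemma tensor3_eq_sum:
  assumes "\<And>i. i \<in> I \<Longrightarrow> tensor3_eq s (F i) (G i)"
  shows "tensor3_eq s (\<Sum>i\<in>I. F i) (\<Sum>i\<in>I. G i)"
  using assms by (induction I rule: infinite_finite_induct)
    (auto intro: tensor3_eq.refl tensor3_eq_add)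

lemma tensor_eq_sum_left:
  assumes "finite I"
  shows "tensor_eq sV sW {#(\<Sum>i\<in>I. v i, w)#} (\<Sum>i\<in>I. {#(v i, w)#})"
  using assms
proof (induction I)
  case (insert i I)
  have "tensor_eq sV sW {#(v i + (\<Sum>i\<in>I. v i), w)#} {#(v i, w), (\<Sum>i\<in>I. v i, w)#}"
    by (rule tensor_eq.add_left)
  moreover have "tensor_eq sV sW ({#(v i, w)#} + {#(\<Sum>i\<in>I. v i, w)#}) ({#(v i, w)#} + (\<Sum>i\<in>I. {#(v i, w)#}))"
    by (intro tensor_eq_add tensor_eq.refl insert.IH)
  ultimately show ?case
    using insert.hyps tensor_eq.trans by (fastforce simp: add_mset_commute)
qed (simp add: tensor_eq.zero)

lemma sum_mset_of_sum:
  "(\<Sum>p\<in>#(\<Sum>i\<in>I. {#q i#}). F p) = (\<Sum>i\<in>I. F (q i))"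
  if "finite I" for F :: "_ \<Rightarrow> _::comm_monoid_add"
  using that by (induction I) auto

lemma image_mset_of_sum:
  "image_mset F (\<Sum>i\<in>I. {#q i#}) = (\<Sum>i\<in>I. {#F (q i)#})" if "finite I"
  using that by (induction I) auto

lemma sum_mset_of_sum': "\<Sum>\<^sub># (\<Sum>i\<in>I. {#q i#}) = (\<Sum>i\<in>I. q i)" if "finite I"
  using that by (induction I) auto

lemma single_sum: "Poly_Mapping.single t (\<Sum>i\<in>I. c i) = (\<Sum>i\<in>I. Poly_Mapping.single t (c i))"
  by (induction I rule: infinite_finite_induct) (auto simp: single_add)

lemma if_single: "Poly_Mapping.single t (if b then c else 0) = (if b then Poly_Mapping.single t c else 0)"
  by simp

lemma if_mult: "(if b then c else 0) * d = (if b then c * d else (0 :: _ :: ring_1))"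
    "d * (if b then c else 0) = (if b then d * c else 0)"
  by simp_all

lemma poly_mapping_expand:
  fixes a :: "'g::finite \<Rightarrow>\<^sub>0 'k::comm_monoid_add"
  shows "(\<Sum>t\<in>UNIV. Poly_Mapping.single t (Poly_Mapping.lookup a t)) = a"
  by (rule poly_mapping_eqI) (simp add: lookup_sum lookup_single when_def)

lemma poly_mapping_mult_expand:
  fixes a b :: "'g::{finite,group_add} \<Rightarrow>\<^sub>0 'k::semiring_0"
  shows "a * b = (\<Sum>s\<in>UNIV. \<Sum>t\<in>UNIV.
    Poly_Mapping.single (s + t) (Poly_Mapping.lookup a s * Poly_Mapping.lookup b t))"
  by (subst poly_mapping_expand[of a, symmetric], subst poly_mapping_expand[of b, symmetric])
     (simp add: sum_product mult_single)

lemma lookup_scale: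
  fixes a :: "'g::{finite,group_add} \<Rightarrow>\<^sub>0 'k::field"
  shows "Poly_Mapping.lookup (Poly_Mapping.single 0 c * a) t = c * Poly_Mapping.lookup a t"
  by (subst poly_mapping_expand[of a, symmetric])
     (simp add: sum_distrib_left mult_single lookup_sum lookup_single when_def)

lemma scale_comm:
  fixes a :: "'g::{finite,group_add} \<Rightarrow>\<^sub>0 'k::field"
  shows "a * Poly_Mapping.single 0 c = Poly_Mapping.single 0 c * a"
  by (subst (1 2) poly_mapping_expand[of a, symmetric])
     (simp add: sum_distrib_left sum_distrib_right mult_single mult.commute)

lemma single_mult_0: "Poly_Mapping.single 0 c * Poly_Mapping.single t d = Poly_Mapping.single t (c * d)"
  for t :: "'g::group_add" and c :: "'k::field"
  by (simp add: mult_single)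

lemma hopf_algebra_group_hopf:
  "hopf_algebra (group_hopf :: ('k::field, 'g::{group_add,finite} \<Rightarrow>\<^sub>0 'k) hopf)"
proof -
  let ?G = "group_hopf :: ('k, 'g \<Rightarrow>\<^sub>0 'k) hopf"
  have vs: "vector_space (hscale ?G)"
    by unfold_locales
       (simp_all add: group_hopf_def algebra_simps single_add mult_single flip: mult.assoc)
  show ?thesis
  proof
    fix c d :: 'k and u v :: "'g \<Rightarrow>\<^sub>0 'k"
    note [simp] = group_hopf_def sum_mset_of_sum single_mult_0 lookup_scale
    have [simp]: "Poly_Mapping.lookup (1 :: 'g \<Rightarrow>\<^sub>0 'k) t = (if t = 0 then 1 else 0)" for t
      by (simp add: lookup_one when_def)
    have [simp]: "Poly_Mapping.single 0 1 = (1 :: 'g \<Rightarrow>\<^sub>0 'k)" by simp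
    show "hscale ?G c (u + v) = hscale ?G c u + hscale ?G c v"
      "hscale ?G (c + d) u = hscale ?G c u + hscale ?G d u"
      "hscale ?G c (hscale ?G d u) = hscale ?G (c * d) u"
      "hscale ?G 1 u = u"
      using vs by (auto simp: vector_space_def)
    show "hscale ?G c u * v = hscale ?G c (u * v)" by (simp add: mult.assoc)
    show "u * hscale ?G c v = hscale ?G c (u * v)" by (simp add: scale_comm flip: mult.assoc)
    show "hopf_tensor_eq ?G (comult ?G (u + v)) (comult ?G u + comult ?G v)"
      by (simp add: lookup_add single_add flip: sum.distrib)
         (subst add_mset_commute, intro tensor_eq_sum tensor_eq.add_left)
    show "hopf_tensor_eq ?G (comult ?G (hscale ?G c u))
          (\<Sum>(u1, u2)\<in>#comult ?G u. {#(hscale ?G c u1, u2)#})"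
      by (simp add: tensor_eq.refl)
    show "tensor3_eq (hscale ?G)
          (\<Sum>(u1, u2)\<in>#comult ?G u. \<Sum>(a, b)\<in>#comult ?G u1. {#(a, b, u2)#})
          (\<Sum>(u1, u2)\<in>#comult ?G u. \<Sum>(a, b)\<in>#comult ?G u2. {#(u1, a, b)#})"
    proof -
      have 1: "tensor3_eq (hscale ?G) {#(0, v, w)#} {#}" for v w
        by (rule tensor3_eq.zero)
      have 2: "tensor3_eq (hscale ?G) {#(v, 0, w)#} {#}" for v w
        using tensor3_eq.sym[OF tensor3_eq.scale_12[of "hscale ?G" 0 v 0 w]] 1[of 0 w]
        by (auto intro: tensor3_eq.trans)
      let ?M = "\<lambda>t. {#(Poly_Mapping.single t (Poly_Mapping.lookup u t), grp_elt t, grp_elt t)#}"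
      have "tensor3_eq (hscale ?G)
          (\<Sum>(u1, u2)\<in>#comult ?G u. \<Sum>(a, b)\<in>#comult ?G u1. {#(a, b, u2)#})
          (\<Sum>t\<in>UNIV. \<Sum>s\<in>UNIV. if s = t then ?M t else {#})"
        by (simp add: lookup_single del: sum.delta sum.delta', intro tensor3_eq_sum)
           (use 1 in \<open>auto simp: when_def intro: tensor3_eq.refl\<close>)
      moreover have "tensor3_eq (hscale ?G)
          (\<Sum>(u1, u2)\<in>#comult ?G u. \<Sum>(a, b)\<in>#comult ?G u2. {#(u1, a, b)#})
          (\<Sum>t\<in>UNIV. \<Sum>s\<in>UNIV. if s = t then ?M t else {#})"
        by (simp add: lookup_single del: sum.delta sum.delta', intro tensor3_eq_sum)
           (use 2 in \<open>auto simp: when_def intro: tensor3_eq.refl\<close>)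
      ultimately show ?thesis by (blast intro: tensor3_eq.sym tensor3_eq.trans)
    qed
    show "(\<Sum>(u1, u2)\<in>#comult ?G u. hscale ?G (counit ?G u1) u2) = u"
      by (simp add: lookup_single when_def poly_mapping_expand)
    show "(\<Sum>(u1, u2)\<in>#comult ?G u. hscale ?G (counit ?G u2) u1) = u"
      by (simp add: lookup_single when_def poly_mapping_expand)
    show "hopf_tensor_eq ?G (comult ?G 1) {#(1, 1)#}"
    proof -
      have "tensor_eq (hscale ?G) (hscale ?G)
        (\<Sum>t\<in>UNIV. {#(Poly_Mapping.single t (Poly_Mapping.lookup 1 t), grp_elt t)#})
        (\<Sum>t::'g\<in>UNIV. if t = 0 then {#(1, 1)#} else {#})"
        by (intro tensor_eq_sum) (auto intro: tensor_eq.refl tensor_eq.zero)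
      then show ?thesis by simp
    qed
    show "hopf_tensor_eq ?G (comult ?G (u * v))
          (\<Sum>(u1, u2)\<in>#comult ?G u. \<Sum>(v1, v2)\<in>#comult ?G v. {#(u1 * v1, u2 * v2)#})"
    proof -
      let ?e = "\<lambda>s t. Poly_Mapping.single (s + t) (Poly_Mapping.lookup u s * Poly_Mapping.lookup v t)"
      let ?eq = "tensor_eq (hscale ?G) (hscale ?G)"
      have *: "Poly_Mapping.single r (Poly_Mapping.lookup (u * v) r) =
          (\<Sum>p\<in>UNIV. if fst p + snd p = r then ?e (fst p) (snd p) else 0)" for r
      proof (rule poly_mapping_eqI)
        fix k
        show "Poly_Mapping.lookup (Poly_Mapping.single r (Poly_Mapping.lookup (u * v) r)) k =
          Poly_Mapping.lookup (\<Sum>p\<in>UNIV. if fst p + snd p = r then ?e (fst p) (snd p) else 0) k"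
          by (subst poly_mapping_mult_expand)
             (auto simp: lookup_single lookup_sum when_def sum.cartesian_product split_def
               intro!: sum.cong sum.neutral)
      qed
      have "?eq (comult ?G (u * v))
          (\<Sum>r\<in>UNIV. \<Sum>p\<in>UNIV. {#(if fst p + snd p = r then ?e (fst p) (snd p) else 0, grp_elt r)#})"
        by (simp add: *) (intro tensor_eq_sum tensor_eq_sum_left finite_UNIV)
      moreover have "?eq
          (\<Sum>r\<in>UNIV. \<Sum>p\<in>UNIV. {#(if fst p + snd p = r then ?e (fst p) (snd p) else 0, grp_elt r)#})
          (\<Sum>r\<in>UNIV. \<Sum>p\<in>UNIV. if fst p + snd p = r then {#(?e (fst p) (snd p), grp_elt r)#} else {#})"
        by (intro tensor_eq_sum) (auto intro: tensor_eq.refl tensor_eq.zero)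
      moreover have "(\<Sum>r\<in>UNIV. \<Sum>p\<in>UNIV.
            if fst p + snd p = r then {#(?e (fst p) (snd p), grp_elt r)#} else {#}) =
          (\<Sum>(u1, u2)\<in>#comult ?G u. \<Sum>(v1, v2)\<in>#comult ?G v. {#(u1 * v1, u2 * v2)#})"
        by (subst sum.swap) (simp add: sum.cartesian_product split_def mult_single image_mset_of_sum sum_mset_of_sum')
      ultimately show ?thesis by (simp only:) (rule tensor_eq.trans)
    qed
    show "counit ?G 1 = 1" by simp
    show "counit ?G (u * v) = counit ?G u * counit ?G v"
    proof -
      have "counit ?G (u * v) = (\<Sum>s\<in>UNIV. \<Sum>t\<in>UNIV. counit ?G
          (Poly_Mapping.single (s + t) (Poly_Mapping.lookup u s * Poly_Mapping.lookup v t)))"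
      proof -
        have "counit ?G (sum F I) = (\<Sum>i\<in>I. counit ?G (F i))" if "finite I" for F and I :: "'g set"
          using that by (induction I) (simp_all add: lookup_add sum.distrib)
        then show ?thesis by (simp only: poly_mapping_mult_expand[of u v] finite_UNIV)
      qed
      then show ?thesis
        by (simp add: lookup_single when_def sum_product)
    qed
    show "(\<Sum>(u1, u2)\<in>#comult ?G u. antipode ?G u1 * u2) = hscale ?G (counit ?G u) 1"
      by (simp add: sum_distrib_right mult_single lookup_single when_def single_sum if_single if_mult)
    show "(\<Sum>(u1, u2)\<in>#comult ?G u. u1 * antipode ?G u2) = hscale ?G (counit ?G u) 1"
      by (simp add: sum_distrib_left mult_single lookup_single when_def single_sum if_single if_mult)
  qed (simp_all add: group_hopf_def algebra_simps lookup_add lookup_scale single_add sum.distrib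
         sum_distrib_left mult_single)
qed

definition generated_subgroup :: "'g::group_add set \<Rightarrow> 'g set" where
  "generated_subgroup S =
    \<Inter>{T. S \<subseteq> T \<and> 0 \<in> T \<and> (\<forall>s\<in>T. \<forall>t\<in>T. s + t \<in> T) \<and> (\<forall>t\<in>T. - t \<in> T)}"


section \<open>Algebras given by generators and relations\<close>

text \<open>The free monoid on \<open>'a\<close>; lists carry no \<open>monoid_add\<close> instance.\<close>

datatype 'a word = Word (letters: "'a list")

instantiation word :: (type) monoid_add
begin

definition zero_word :: "'a word" where
  "0 = Word []"

definition plus_word :: "'a word \<Rightarrow> 'a word \<Rightarrow> 'a word" where
  "u + v = Word (letters u @ letters v)"

instance
  by standard (simp_all add: zero_word_def plus_word_def)

end

text \<open>The free algebra \<open>k\<langle>'a\<rangle>\<close> is the monoid algebra of the free monoid.\<close>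

type_synonym ('k, 'a) free_algebra = "'a word \<Rightarrow>\<^sub>0 'k"

definition gen :: "'a \<Rightarrow> ('k::zero_neq_one, 'a) free_algebra" where
  "gen a = Poly_Mapping.single (Word [a]) 1"

definition free_eval ::
  "('k::field \<Rightarrow> 'h \<Rightarrow> 'h) \<Rightarrow> ('a \<Rightarrow> 'h) \<Rightarrow> ('k, 'a) free_algebra \<Rightarrow> 'h::ring_1" where
  "free_eval s \<phi> P =
    (\<Sum>w\<in>Poly_Mapping.keys P. s (Poly_Mapping.lookup P w) (prod_list (List.map \<phi> (letters w))))"

definition generated_ideal :: "'r::ring_1 set \<Rightarrow> 'r set" where
  "generated_ideal R =
    \<Inter>{I. R \<subseteq> I \<and> 0 \<in> I \<and> (\<forall>P\<in>I. \<forall>Q\<in>I. P + Q \<in> I) \<and> (\<forall>P\<in>I. \<forall>a b. a * P * b \<in> I)}"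

definition presented_by ::
  "('k::field \<Rightarrow> 'h \<Rightarrow> 'h) \<Rightarrow> ('a \<Rightarrow> 'h::ring_1) \<Rightarrow> ('k, 'a) free_algebra set \<Rightarrow> bool" where
  "presented_by s \<phi> R \<longleftrightarrow>
    surj (free_eval s \<phi>) \<and> {P. free_eval s \<phi> P = 0} = generated_ideal R"


section \<open>The Hopf algebras of the third type\<close>

locale third_type_datum =
  fixes g :: "'g::{group_add,finite}"
    and f :: "'g \<Rightarrow> 'k::alg_closed_field"
  assumes central: "g + t = t + g"
    and f_hom: "f (s + t) = f s + f t"
    and f_g: "f g = 1"
    and f_power: "(Poly_Mapping.single 0 (f t ^ CHAR('k) - f t) :: 'g \<Rightarrow>\<^sub>0 'k) *
          (1 - grp_elt g ^ CHAR('k)) = 0"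

datatype 'g letter = T 'g | X

text \<open>The first two families of relations make \<open>t \<mapsto> gen (T t)\<close> extend to \<open>k[G]\<close>.\<close>

definition third_type_relations ::
  "'g::group_add \<Rightarrow> ('g \<Rightarrow> 'k::field) \<Rightarrow> ('k, 'g letter) free_algebra set" where
  "third_type_relations g f =
    {gen (T 0) - 1} \<union>
    {gen (T s) * gen (T t) - gen (T (s + t)) | s t. True} \<union>
    {gen (T t) * gen X - gen X * gen (T t)
       - Poly_Mapping.single 0 (f t) * gen (T t) * (1 - gen (T g)) | t. True} \<union>
    {gen X ^ CHAR('k) - gen X}"

text \<open>
  \<open>H\<close> is the Hopf algebra \<open>\<AA>\<^sup>3\<^sub>G(g, f)\<close>, where \<open>\<iota> t\<close> is the image of \<open>t \<in> G\<close> in \<open>H\<close> and \<open>x\<close> the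
  additional generator. As comultiplication, counit and antipode are determined by their values
  on the generators, this fixes \<open>(H, \<iota>, x)\<close> up to isomorphism.
\<close>

locale third_type_hopf_algebra =
  third_type_datum g f + hopf_algebra H
  for g :: "'g::{group_add,finite}"
    and f :: "'g \<Rightarrow> 'k::alg_closed_field"
    and H :: "('k, 'h::ring_1) hopf" +
  fixes \<iota> :: "'g \<Rightarrow> 'h"
    and x :: 'h
  assumes presentation:
      "presented_by (hscale H) (case_letter \<iota> x) (third_type_relations g f)"
    and comult_grp: "hopf_tensor_eq H (comult H (\<iota> t)) {#(\<iota> t, \<iota> t)#}"
    and counit_grp: "counit H (\<iota> t) = 1"
    and antipode_grp: "antipode H (\<iota> t) = \<iota> (- t)"
    and comult_x: "hopf_tensor_eq H (comult H x) {#(x, 1), (\<iota> g, x)#}"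
    and counit_x: "counit H x = 0"
    and antipode_x: "antipode H x = - (\<iota> (- g) * x)"

end

theory Submission
  imports Defs
begin

text \<open>
  Fix \<open>h \<in> \<Gamma>\<close> and put \<open>a = g \<triangleright> h\<close>, \<open>y = x \<triangleright> h\<close>. Since \<open>\<Delta>(x) = x \<otimes> 1 + g \<otimes> x\<close> and \<open>1 \<triangleleft> h = 1\<close>,
  the last compatibility condition of the matched pair, taken at \<open>x\<close> and \<open>h\<close>, reads
  \<open>(x \<triangleleft> h) \<otimes> h + (g \<triangleleft> h) \<otimes> y = 1 \<otimes> y + (x \<triangleleft> h) \<otimes> a\<close>, that is,
  \<open>(x \<triangleleft> h) \<otimes> (h - a) = (1 - g \<triangleleft> h) \<otimes> y\<close>. If \<open>a \<noteq> h\<close>, some coordinate of \<open>h - a\<close> is nonzero, and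
  comparing that coordinate in the second tensor factor gives \<open>x \<triangleleft> h = c (1 - g \<triangleleft> h)\<close> for a scalar
  \<open>c\<close>. Acting by \<open>h\<^sup>-\<^sup>1\<close> from the right turns this into \<open>x = c (1 - g)\<close>. No such equation holds in
  \<open>H\<close>: the defining relations are respected by sending every \<open>t \<in> G\<close> and \<open>x\<close> to \<open>1 \<in> k\<close>, and this
  character separates \<open>x\<close> from all multiples of \<open>1 - g\<close> (\<open>x_notin_span\<close>). Hence \<open>a = h\<close>.

  Now \<open>\<Delta>(y) = y \<otimes> h + h \<otimes> y\<close>, and a group algebra has no nonzero element of this kind, because
  the coproduct of \<open>k[\<Gamma>]\<close> is supported on the diagonal: the coefficient at \<open>s \<otimes> s\<close> is \<open>y(s)\<close> on the
  left, but \<open>0\<close> for \<open>s \<noteq> h\<close> and \<open>2 y(h)\<close> for \<open>s = h\<close> on the right. So \<open>y = 0\<close>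
  (\<open>lact_skew_primitive\<close>).

  The elements of \<open>G\<close> that fix \<open>\<Gamma>\<close> pointwise form a subgroup. If \<open>g\<close> generates \<open>G\<close>, all generators
  of \<open>H\<close> therefore act through the counit, and so does everything else, since the elements \<open>u\<close> with
  \<open>u \<triangleright> h = \<epsilon>(u) h\<close> for all \<open>h\<close> form a subalgebra.
\<close>

section \<open>Evaluating tensors\<close>

text \<open>
  This is the universal property of the tensor product. It is the only way in which equations
  between tensors are used below: they are tested against coordinate forms.
\<close>

lemma tensor_eq_bilinear:
  fixes B :: "'v::ab_group_add \<Rightarrow> 'w::ab_group_add \<Rightarrow> 'c::ab_group_add"
  assumes "tensor_eq sV sW M N"
    and add_left: "\<And>v v' w. B (v + v') w = B v w + B v' w"
    and add_right: "\<And>v w w'. B v (w + w') = B v w + B v w'"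
    and balanced: "\<And>c v w. B (sV c v) w = B v (sW c w)"
  shows "(\<Sum>(v, w)\<in>#M. B v w) = (\<Sum>(v, w)\<in>#N. B v w)"
  using assms(1)
proof (induction rule: tensor_eq.induct)
  case (zero w)
  show ?case using add_left[of 0 0 w] by simp
qed (simp_all add: add_left add_right balanced)

lemma sum_mset_sum_mset:
  "(\<Sum>p\<in>#(\<Sum>i\<in>#M. F i). B p) = (\<Sum>i\<in>#M. \<Sum>p\<in>#F i. B p)"
  by (induction M) auto

text \<open>
  The representative \<open>comult group_hopf (grp_elt h)\<close> contains a summand \<open>0 \<otimes> t\<close> for each \<open>t \<noteq> h\<close>;
  hence the hypothesis on \<open>F\<close>.
\<close>

lemma sum_comult_grp_elt:
  assumes "\<And>w. F 0 w = 0"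
  shows "(\<Sum>(a1, a2)\<in>#comult group_hopf (grp_elt h). F a1 a2) =
    (F (grp_elt h) (grp_elt h) :: 'c::comm_monoid_add)"
proof -
  have "(\<Sum>(a1, a2)\<in>#comult group_hopf (grp_elt h). F a1 a2) =
      (\<Sum>t\<in>UNIV. if h = t then F (grp_elt h) (grp_elt h) else 0)"
    by (simp only: group_hopf_def hopf.simps sum_mset_of_sum[OF finite_UNIV] prod.case)
       (rule sum.cong, auto simp: lookup_single when_def assms)
  then show ?thesis by simp
qed

section \<open>Matched pairs with a group algebra\<close>

lemmas linear_facts =
  module_hom.add[OF Vector_Spaces.linear.axioms(3)]
  module_hom.diff[OF Vector_Spaces.linear.axioms(3)]
  module_hom.zero[OF Vector_Spaces.linear.axioms(3)]
  module_hom.scale[OF Vector_Spaces.linear.axioms(3)]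

context
  fixes H :: "('k::field, 'h::ring_1) hopf"
    and lact :: "'h \<Rightarrow> ('\<gamma>::{group_add,finite} \<Rightarrow>\<^sub>0 'k) \<Rightarrow> ('\<gamma> \<Rightarrow>\<^sub>0 'k)"
    and ract :: "'h \<Rightarrow> ('\<gamma> \<Rightarrow>\<^sub>0 'k) \<Rightarrow> 'h"
  assumes mp: "matched_pair group_hopf H lact ract"
begin

interpretation matched_pair group_hopf H lact ract by (rule mp)
interpretation H: vector_space "hscale H"
  using hopf_algebra.vector_space[OF hopf_H] .

text \<open>
  The coordinate at \<open>s \<otimes> t\<close> of \<open>\<Delta>(u \<triangleright> h) = \<Sum> (u\<^sub>1 \<triangleright> h) \<otimes> (u\<^sub>2 \<triangleright> h)\<close>. The sum is bilinear in \<open>u\<^sub>1\<close> and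
  \<open>u\<^sub>2\<close>, so any representative \<open>M\<close> of \<open>\<Delta>(u)\<close> may be used.
\<close>

lemma lact_lookup_comult:
  assumes M: "hopf_tensor_eq H (comult H u) M"
  shows "(if s = t then Poly_Mapping.lookup (lact u (grp_elt h)) s else 0) =
    (\<Sum>(u1, u2)\<in>#M. Poly_Mapping.lookup (lact u1 (grp_elt h)) s *
      Poly_Mapping.lookup (lact u2 (grp_elt h)) t)"
proof -
  let ?B = "\<lambda>a b. Poly_Mapping.lookup a s * Poly_Mapping.lookup b t"
  note [simp] = linear_facts[OF lact_linear_left] linear_facts[OF lact_linear_right]
  have scale: "Poly_Mapping.lookup (hscale group_hopf c a) r = c * Poly_Mapping.lookup a r"
    for c r and a :: "'\<gamma> \<Rightarrow>\<^sub>0 'k"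
    by (simp add: group_hopf_def lookup_scale)
  have "(if s = t then Poly_Mapping.lookup (lact u (grp_elt h)) s else 0) =
      (\<Sum>(a, b)\<in>#comult group_hopf (lact u (grp_elt h)). ?B a b)"
    by (simp add: group_hopf_def sum_mset_of_sum lookup_single when_def if_mult)
  also have "\<dots> = (\<Sum>(a, b)\<in>#(\<Sum>(u1, u2)\<in>#comult H u.
      \<Sum>(a1, a2)\<in>#comult group_hopf (grp_elt h). {#(lact u1 a1, lact u2 a2)#}). ?B a b)"
    by (rule tensor_eq_bilinear[OF lact_comult]) (simp_all add: lookup_add algebra_simps scale)
  also have "\<dots> = (\<Sum>(u1, u2)\<in>#comult H u.
      \<Sum>(a1, a2)\<in>#comult group_hopf (grp_elt h). ?B (lact u1 a1) (lact u2 a2))"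
    by (simp add: sum_mset_sum_mset case_prod_unfold multiset.map_comp comp_def)
  also have "\<dots> = (\<Sum>(u1, u2)\<in>#comult H u. ?B (lact u1 (grp_elt h)) (lact u2 (grp_elt h)))"
    by (simp add: sum_comult_grp_elt)
  also have "\<dots> = (\<Sum>(u1, u2)\<in>#M. ?B (lact u1 (grp_elt h)) (lact u2 (grp_elt h)))"
    by (rule tensor_eq_bilinear[OF M]) (simp_all add: lookup_add algebra_simps scale)
  finally show ?thesis .
qed

text \<open>
  The image of \<open>\<Sum> (u\<^sub>1 \<triangleleft> h) \<otimes> (u\<^sub>2 \<triangleright> h) = \<Sum> (u\<^sub>2 \<triangleleft> h) \<otimes> (u\<^sub>1 \<triangleright> h)\<close> under the map \<open>v \<otimes> a \<mapsto> a(r) v\<close>.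
\<close>

lemma twist_lookup:
  assumes M: "hopf_tensor_eq H (comult H u) M"
  shows "(\<Sum>(u1, u2)\<in>#M.
      hscale H (Poly_Mapping.lookup (lact u2 (grp_elt h)) r) (ract u1 (grp_elt h))) =
    (\<Sum>(u1, u2)\<in>#M.
      hscale H (Poly_Mapping.lookup (lact u1 (grp_elt h)) r) (ract u2 (grp_elt h)))"
proof -
  let ?B = "\<lambda>v a. hscale H (Poly_Mapping.lookup a r) v"
  let ?C = "comult group_hopf (grp_elt h :: '\<gamma> \<Rightarrow>\<^sub>0 'k)"
  note [simp] = linear_facts[OF lact_linear_left] linear_facts[OF lact_linear_right]
    linear_facts[OF ract_linear_left] linear_facts[OF ract_linear_right]
    H.scale_left_distrib H.scale_right_distrib
  have scale [simp]: "Poly_Mapping.lookup (hscale group_hopf c a) r = c * Poly_Mapping.lookup a r"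
    for c and a :: "'\<gamma> \<Rightarrow>\<^sub>0 'k"
    by (simp add: group_hopf_def lookup_scale)
  have "(\<Sum>(v, a)\<in>#(\<Sum>(u1, u2)\<in>#comult H u. \<Sum>(a1, a2)\<in>#?C. {#(ract u1 a1, lact u2 a2)#}). ?B v a) =
      (\<Sum>(v, a)\<in>#(\<Sum>(u1, u2)\<in>#comult H u. \<Sum>(a1, a2)\<in>#?C. {#(ract u2 a2, lact u1 a1)#}). ?B v a)"
    by (rule tensor_eq_bilinear[OF twist]) (simp_all add: lookup_add mult.commute)
  then have "(\<Sum>(u1, u2)\<in>#comult H u. \<Sum>(a1, a2)\<in>#?C. ?B (ract u1 a1) (lact u2 a2)) =
      (\<Sum>(u1, u2)\<in>#comult H u. \<Sum>(a1, a2)\<in>#?C. ?B (ract u2 a2) (lact u1 a1))"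
    by (simp add: sum_mset_sum_mset case_prod_unfold multiset.map_comp comp_def)
  then have *: "(\<Sum>(u1, u2)\<in>#comult H u. ?B (ract u1 (grp_elt h)) (lact u2 (grp_elt h))) =
      (\<Sum>(u1, u2)\<in>#comult H u. ?B (ract u2 (grp_elt h)) (lact u1 (grp_elt h)))"
    by (simp add: sum_comult_grp_elt)
  have "(\<Sum>(u1, u2)\<in>#comult H u. ?B (ract u1 (grp_elt h)) (lact u2 (grp_elt h))) =
      (\<Sum>(u1, u2)\<in>#M. ?B (ract u1 (grp_elt h)) (lact u2 (grp_elt h)))"
    by (rule tensor_eq_bilinear[OF M]) (simp_all add: lookup_add mult.commute)
  moreover have "(\<Sum>(u1, u2)\<in>#comult H u. ?B (ract u2 (grp_elt h)) (lact u1 (grp_elt h))) =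
      (\<Sum>(u1, u2)\<in>#M. ?B (ract u2 (grp_elt h)) (lact u1 (grp_elt h)))"
    by (rule tensor_eq_bilinear[OF M]) (simp_all add: lookup_add mult.commute)
  ultimately show ?thesis using * by simp
qed

lemma ract_grp_elt_cancel: "ract (ract u (grp_elt h)) (grp_elt (- h)) = u"
  using ract_mult[of u "grp_elt h" "grp_elt (- h)"] by (simp add: mult_single ract_one)

text \<open>
  If \<open>g\<close> moved \<open>h\<close>, the twist condition at \<open>x\<close> and \<open>h\<close> could be solved for \<open>x \<triangleleft> h\<close>; since \<open>\<triangleleft> h\<close> is
  invertible and fixes \<open>1\<close>, this would make \<open>x\<close> a trivial skew-primitive \<open>c (1 - g)\<close>. Once \<open>g\<close> fixes
  \<open>h\<close>, the coordinates of \<open>\<Delta>(x \<triangleright> h)\<close> on the diagonal force \<open>x \<triangleright> h = 0\<close>.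
\<close>

lemma lact_skew_primitive:
  assumes g: "hopf_tensor_eq H (comult H g) {#(g, g)#}"
    and x: "hopf_tensor_eq H (comult H x) {#(x, 1), (g, x)#}"
    and x_notin: "\<And>c. x \<noteq> hscale H c (1 - g)"
  shows "lact g (grp_elt h) = grp_elt h" "lact x (grp_elt h) = 0"
proof -
  let ?a = "Poly_Mapping.lookup (lact g (grp_elt h))"
  let ?y = "Poly_Mapping.lookup (lact x (grp_elt h))"
  let ?h = "Poly_Mapping.lookup (grp_elt h :: '\<gamma> \<Rightarrow>\<^sub>0 'k)"
  have one: "ract 1 (grp_elt t) = 1" for t :: '\<gamma>
    by (simp add: one_ract group_hopf_def lookup_single when_def)
  show fixed: "lact g (grp_elt h) = grp_elt h"
  proof (rule poly_mapping_eqI, rule ccontr)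
    fix r
    assume ne: "?a r \<noteq> ?h r"
    have scaled: "hscale H (?h r - ?a r) (ract x (grp_elt h)) =
        hscale H (?y r) (1 - ract g (grp_elt h))"
      using twist_lookup[OF x, of h r]
      by (simp add: one lact_one H.scale_left_diff_distrib H.scale_right_diff_distrib algebra_simps)
    have "ract x (grp_elt h) =
        hscale H (inverse (?h r - ?a r)) (hscale H (?h r - ?a r) (ract x (grp_elt h)))"
      using ne by simp
    also have "\<dots> = hscale H (?y r / (?h r - ?a r)) (1 - ract g (grp_elt h))"
      by (simp only: scaled) (simp add: divide_inverse mult.commute)
    finally have "ract (ract x (grp_elt h)) (grp_elt (- h)) =
        hscale H (?y r / (?h r - ?a r)) (1 - ract (ract g (grp_elt h)) (grp_elt (- h)))"
      by (simp add: linear_facts[OF ract_linear_left] one)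
    then show False using x_notin by (simp add: ract_grp_elt_cancel)
  qed
  show "lact x (grp_elt h) = 0"
  proof (rule poly_mapping_eqI)
    fix s
    \<comment> \<open>At \<open>s = h\<close> the comparison gives \<open>y(h) = 2 y(h)\<close>, in any characteristic.\<close>
    have "(2 :: 'k) \<noteq> 1"
      by (metis add_cancel_right_right one_add_one zero_neq_one)
    then show "?y s = Poly_Mapping.lookup 0 s"
      using lact_lookup_comult[OF x, of s s h]
      by (cases "s = h") (simp_all add: fixed lact_one lookup_single)
  qed
qed

end

section \<open>Evaluation of free algebras\<close>

locale algebra_over =
  vector_space s for s :: "'k::field \<Rightarrow> 'h::ring_1 \<Rightarrow> 'h" +
  assumes mult_left: "s c u * v = s c (u * v)"
    and mult_right: "u * s c v = s c (u * v)"
begin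

lemma free_eval_supset:
  assumes "finite K" "Poly_Mapping.keys P \<subseteq> K"
  shows "free_eval s \<phi> P =
    (\<Sum>w\<in>K. s (Poly_Mapping.lookup P w) (prod_list (List.map \<phi> (letters w))))"
  unfolding free_eval_def using assms
  by (intro sum.mono_neutral_left) (auto simp: in_keys_iff)

lemma free_eval_add: "free_eval s \<phi> (P + Q) = free_eval s \<phi> P + free_eval s \<phi> Q"
proof -
  let ?K = "Poly_Mapping.keys P \<union> Poly_Mapping.keys Q"
  show ?thesis
    using keys_add[of P Q]
    by (simp add: free_eval_supset[of ?K] lookup_add scale_left_distrib sum.distrib)
qed

lemma free_eval_zero [simp]: "free_eval s \<phi> 0 = 0"
  by (simp add: free_eval_def)

lemma free_eval_diff: "free_eval s \<phi> (P - Q) = free_eval s \<phi> P - free_eval s \<phi> Q"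
  using free_eval_add[of \<phi> "P - Q" Q] by simp

lemma free_eval_single:
  "free_eval s \<phi> (Poly_Mapping.single w c) = s c (prod_list (List.map \<phi> (letters w)))"
  by (simp add: free_eval_supset[of "{w}"])

lemma free_eval_const [simp]: "free_eval s \<phi> (Poly_Mapping.single 0 c) = s c 1"
  by (simp add: free_eval_single zero_word_def)

lemma free_eval_one [simp]: "free_eval s \<phi> 1 = 1"
  using free_eval_const[of \<phi> 1] by simp

lemma free_eval_gen [simp]: "free_eval s \<phi> (gen a) = \<phi> a"
  by (simp add: gen_def free_eval_single)

lemma free_eval_sum: "free_eval s \<phi> (\<Sum>i\<in>I. F i) = (\<Sum>i\<in>I. free_eval s \<phi> (F i))"
  by (induction I rule: infinite_finite_induct) (auto simp: free_eval_add)

lemma free_eval_mult: "free_eval s \<phi> (P * Q) = free_eval s \<phi> P * free_eval s \<phi> Q"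
proof -
  have expand: "(\<Sum>w\<in>Poly_Mapping.keys P. Poly_Mapping.single w (Poly_Mapping.lookup P w)) = P"
    for P :: "('k, 'b) free_algebra"
    by (rule poly_mapping_eqI) (auto simp: lookup_sum lookup_single when_def in_keys_iff)
  have "P * Q = (\<Sum>v\<in>Poly_Mapping.keys P. \<Sum>w\<in>Poly_Mapping.keys Q.
      Poly_Mapping.single (v + w) (Poly_Mapping.lookup P v * Poly_Mapping.lookup Q w))"
    by (subst expand[of P, symmetric], subst expand[of Q, symmetric])
       (simp add: sum_product mult_single)
  then show ?thesis
    by (simp add: free_eval_sum free_eval_single plus_word_def)
       (simp add: free_eval_def sum_product mult_left mult_right mult.commute)
qed

lemma free_eval_power: "free_eval s \<phi> (P ^ n) = free_eval s \<phi> P ^ n"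
  by (induction n) (simp_all add: free_eval_mult)

text \<open>The kernel of an evaluation is an ideal, so it contains every ideal generated inside it.\<close>

lemma free_eval_generated_ideal:
  assumes "\<And>P. P \<in> R \<Longrightarrow> free_eval s \<phi> P = 0" and "P \<in> generated_ideal R"
  shows "free_eval s \<phi> P = 0"
proof -
  have "generated_ideal R \<subseteq> {P. free_eval s \<phi> P = 0}"
    unfolding generated_ideal_def
    by (rule Inter_lower) (auto simp: assms(1) free_eval_add free_eval_mult)
  then show ?thesis using assms(2) by auto
qed

end

section \<open>The third-type Hopf algebra\<close>

context third_type_hopf_algebra
begin

sublocale H: algebra_over "hscale H"
  using vector_space scale_mult_left scale_mult_right
  by (auto simp: algebra_over_def algebra_over_axioms_def)

text \<open>
  Sending every \<open>t \<in> G\<close> and \<open>x\<close> to \<open>1\<close> is compatible with the relations, as \<open>1 - g\<close> goes to \<open>0\<close> and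
  \<open>1\<^sup>p = 1\<close>. The resulting character maps \<open>x\<close> to \<open>1\<close> and every \<open>c (1 - g)\<close> to \<open>0\<close>. It differs from the
  counit, which kills \<open>x\<close> and could not tell the two apart.
\<close>

lemma x_notin_span: "x \<noteq> hscale H c (1 - \<iota> g)"
proof
  interpret k: algebra_over "(*) :: 'k \<Rightarrow> 'k \<Rightarrow> 'k"
    by unfold_locales (simp_all add: algebra_simps)
  let ?\<chi> = "case_letter (\<lambda>_. 1) 1 :: 'g letter \<Rightarrow> 'k"
  let ?P = "gen X - Poly_Mapping.single 0 c * (1 - gen (T g)) :: ('k, 'g letter) free_algebra"
  assume "x = hscale H c (1 - \<iota> g)"
  then have "free_eval (hscale H) (case_letter \<iota> x) ?P = 0"
    by (simp add: H.free_eval_diff H.free_eval_mult H.mult_left)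
  then have "?P \<in> generated_ideal (third_type_relations g f)"
    using presentation unfolding presented_by_def by blast
  moreover have "free_eval (*) ?\<chi> P = 0" if "P \<in> third_type_relations g f" for P
    using that unfolding third_type_relations_def
    by (auto simp: k.free_eval_diff k.free_eval_mult k.free_eval_power)
  ultimately have "free_eval (*) ?\<chi> ?P = 0"
    using k.free_eval_generated_ideal by blast
  then show False by (simp add: k.free_eval_diff k.free_eval_mult)
qed

lemma relation_holds:
  assumes "P \<in> third_type_relations g f"
  shows "free_eval (hscale H) (case_letter \<iota> x) P = 0"
proof -
  have "P \<in> generated_ideal (third_type_relations g f)"
    unfolding generated_ideal_def using assms by (intro InterI) auto
  then show ?thesis using presentation unfolding presented_by_def by auto
qed

lemma \<iota>_zero: "\<iota> 0 = 1"
  using relation_holds[of "gen (T 0) - 1"]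
  by (simp add: third_type_relations_def H.free_eval_diff)

lemma \<iota>_add: "\<iota> (s + t) = \<iota> s * \<iota> t"
proof -
  have "gen (T s) * gen (T t) - gen (T (s + t)) \<in> third_type_relations g f"
    unfolding third_type_relations_def by blast
  from relation_holds[OF this] show ?thesis
    by (simp add: H.free_eval_diff H.free_eval_mult)
qed

lemma generators_induct:
  assumes "\<And>t. Q (\<iota> t)" "Q x" "Q 1"
    and "\<And>u v. Q u \<Longrightarrow> Q v \<Longrightarrow> Q (u * v)" "\<And>u v. Q u \<Longrightarrow> Q v \<Longrightarrow> Q (u + v)"
    and "\<And>c u. Q u \<Longrightarrow> Q (hscale H c u)"
  shows "Q u"
proof -
  obtain P where u: "u = free_eval (hscale H) (case_letter \<iota> x) P"
    using presentation unfolding presented_by_def by (metis surjD)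
  have word: "Q (prod_list (List.map (case_letter \<iota> x) l))" for l
    by (induction l) (use assms in \<open>auto split: letter.split\<close>)
  have zero: "Q 0" using assms(6)[OF assms(3), of 0] by simp
  have "Q (\<Sum>w\<in>K. hscale H (Poly_Mapping.lookup P w)
      (prod_list (List.map (case_letter \<iota> x) (letters w))))" for K
    by (induction K rule: infinite_finite_induct) (use assms zero word in auto)
  then show ?thesis unfolding u free_eval_def .
qed

end

section \<open>Triviality of the left action\<close>

theorem theorem3p1:
  fixes g :: "'g::{group_add,finite}"
    and f :: "'g \<Rightarrow> 'k::alg_closed_field"
    and H :: "('k, 'h::ring_1) hopf"
    and \<iota> :: "'g \<Rightarrow> 'h"
    and x :: 'h
    and lact :: "'h \<Rightarrow> ('\<gamma>::{group_add,finite} \<Rightarrow>\<^sub>0 'k) \<Rightarrow> ('\<gamma> \<Rightarrow>\<^sub>0 'k)"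
    and ract :: "'h \<Rightarrow> ('\<gamma> \<Rightarrow>\<^sub>0 'k) \<Rightarrow> 'h"
  assumes "CHAR('k) > 0"
    and "third_type_datum g f"
    and "third_type_hopf_algebra g f H \<iota> x"
    and "matched_pair group_hopf H lact ract"
  shows "(\<forall>h::'\<gamma>. lact (\<iota> g) (grp_elt h) = grp_elt h \<and> lact x (grp_elt h) = 0) \<and>
         (generated_subgroup {g} = UNIV \<longrightarrow>
           (\<forall>u (h::'\<gamma>). lact u (grp_elt h) = hscale group_hopf (counit H u) (grp_elt h)))"
proof -
  interpret third_type_hopf_algebra g f H \<iota> x by (rule assms(3))
  interpret matched_pair group_hopf H lact ract by (rule assms(4))
  note g_x = lact_skew_primitive[OF assms(4) comult_grp comult_x x_notin_span]
  have "lact u (grp_elt h) = hscale group_hopf (counit H u) (grp_elt h)"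
    if cyclic: "generated_subgroup {g} = UNIV" for u and h :: '\<gamma>
  proof -
    let ?S = "{t. \<forall>h::'\<gamma>. lact (\<iota> t) (grp_elt h) = grp_elt h}"
    have "- t \<in> ?S" if "t \<in> ?S" for t
    proof -
      have "lact (\<iota> (- t)) (grp_elt h) = grp_elt h" for h :: '\<gamma>
      proof -
        have "lact (\<iota> (- t)) (grp_elt h) = lact (\<iota> (- t)) (lact (\<iota> t) (grp_elt h))"
          using that by simp
        also have "\<dots> = grp_elt h"
          by (simp add: lact_one \<iota>_zero flip: lact_mult \<iota>_add)
        finally show ?thesis .
      qed
      then show ?thesis by simp
    qed
    then have "generated_subgroup {g} \<subseteq> ?S"
      unfolding generated_subgroup_def
      by (intro Inter_lower) (simp add: g_x(1) \<iota>_zero \<iota>_add lact_one lact_mult)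
    then have \<iota>: "lact (\<iota> t) (grp_elt h) = grp_elt h" for t and h :: '\<gamma>
      unfolding cyclic by blast
    note lin = linear_facts[OF lact_linear_left] linear_facts[OF lact_linear_right]
      linear_facts[OF counit_linear]
    interpret A: vector_space "hscale (group_hopf :: ('k, '\<gamma> \<Rightarrow>\<^sub>0 'k) hopf)"
      using hopf_algebra.vector_space[OF hopf_A] .
    show ?thesis
      by (induction u rule: generators_induct)
         (simp_all add: \<iota> g_x counit_grp counit_x counit_one counit_mult lact_one lact_mult lin
           A.scale_left_distrib mult.commute)
  qed
  then show ?thesis using g_x by blast
qed

end
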